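(* Let $n\ge 3$ and $1\le r\le n-2$ be integers, and let $K_n$ be the complete graph on $n$ vertices. If $n$ is even, or $r$ is even, or $n$ is odd and either $r\ge \frac{n-1}{2}$ or $\gcd(r,n-1)=1$, then \[ ms_r(K_n)=\left\lfloor \frac{rn-1}{2}\right\rfloor. \]
   Context: All graphs are simple. For an integer $N$, $[N]=\{0,1,\dots,N-1\}$. An ordering of a graph $G=(V,E)$ is a bijection $\ell:E\to[|E|]$; edges are consecutive in $\ell$ if their labels are consecutive integers. A graph is $(\le r)$-regular if every vertex has degree at most $r$. For an ordering $\ell$ of $G$, $ms_r(\ell)$ is the largest integer $s$ such that every $s$ consecutive edges of $\ell$ form a $(\le r)$-regular subgraph of $G$; $ms_r(G)$ is the maximum of $ms_r(\ell)$ over all orderings $\ell$ of $G$. *)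

theory Defs
  imports Complex_Main
begin

text \<open>A graph is a pair of a vertex set and a set of edges, an edge being the set of its two ends.\<close>

type_synonym 'a graph = "'a set \<times> 'a set set"

abbreviation verts :: "'a graph \<Rightarrow> 'a set" where
  "verts G \<equiv> fst G"

abbreviation edges :: "'a graph \<Rightarrow> 'a set set" where
  "edges G \<equiv> snd G"

definition simple_graph :: "'a graph \<Rightarrow> bool" where
  "simple_graph G \<longleftrightarrow> finite (verts G) \<and> (\<forall>e\<in>edges G. e \<subseteq> verts G \<and> card e = 2)"

definition degree :: "'a graph \<Rightarrow> 'a \<Rightarrow> nat" where
  "degree G v = card {e \<in> edges G. v \<in> e}"

definition le_regular :: "nat \<Rightarrow> 'a graph \<Rightarrow> bool" where
  "le_regular r G \<longleftrightarrow> (\<forall>v\<in>verts G. degree G v \<le> r)"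

definition is_ordering :: "'a graph \<Rightarrow> ('a set \<Rightarrow> nat) \<Rightarrow> bool" where
  "is_ordering G l \<longleftrightarrow> bij_betw l (edges G) {0..<card (edges G)}"

text \<open>The spanning subgraph formed by the \<open>s\<close> consecutive edges labelled \<open>i, \<dots>, i + s - 1\<close>.\<close>

definition window :: "'a graph \<Rightarrow> ('a set \<Rightarrow> nat) \<Rightarrow> nat \<Rightarrow> nat \<Rightarrow> 'a graph" where
  "window G l i s = (verts G, {e \<in> edges G. l e \<in> {i..<i + s}})"

text \<open>Labels do not wrap around. The bound \<open>s \<le> card (edges G)\<close> excludes the vacuous case
  in which there are no \<open>s\<close> consecutive edges.\<close>

definition ms_ordering :: "nat \<Rightarrow> 'a graph \<Rightarrow> ('a set \<Rightarrow> nat) \<Rightarrow> nat" where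
  "ms_ordering r G l = Max {s. s \<le> card (edges G) \<and>
     (\<forall>i. i + s \<le> card (edges G) \<longrightarrow> le_regular r (window G l i s))}"

definition ms :: "nat \<Rightarrow> 'a graph \<Rightarrow> nat" where
  "ms r G = Max {ms_ordering r G l | l. is_ordering G l}"

definition complete_graph :: "nat \<Rightarrow> nat graph" where
  "complete_graph n = ({0..<n}, {e. e \<subseteq> {0..<n} \<and> card e = 2})"

text \<open>Both maxima are taken over finite nonempty sets.\<close>

lemma ms_ordering_set:
  "finite {s. s \<le> card (edges G) \<and>
     (\<forall>i. i + s \<le> card (edges G) \<longrightarrow> le_regular r (window G l i s))}" (is "finite ?S")
  "0 \<in> {s. s \<le> card (edges G) \<and>
     (\<forall>i. i + s \<le> card (edges G) \<longrightarrow> le_regular r (window G l i s))}"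
proof -
  show "finite ?S"
    by (rule finite_subset[of _ "{..card (edges G)}"]) auto
  have "window G l i 0 = (verts G, {})" for i
    by (auto simp: window_def)
  then show "0 \<in> ?S"
    by (simp add: le_regular_def degree_def)
qed

lemma ms_ordering_le: "ms_ordering r G l \<le> card (edges G)"
proof -
  have "ms_ordering r G l \<in> {s. s \<le> card (edges G) \<and>
     (\<forall>i. i + s \<le> card (edges G) \<longrightarrow> le_regular r (window G l i s))}"
    unfolding ms_ordering_def using ms_ordering_set[of G r l] by (intro Max_in) blast+
  then show ?thesis by simp
qed

lemma simple_graph_finite_edges: "simple_graph G \<Longrightarrow> finite (edges G)"
  unfolding simple_graph_def
  by (rule finite_subset[of _ "Pow (verts G)"]) auto

lemma ms_set:
  assumes "simple_graph G"
  shows "finite {ms_ordering r G l | l. is_ordering G l}"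
    and "{ms_ordering r G l | l. is_ordering G l} \<noteq> {}"
proof -
  show "finite {ms_ordering r G l | l. is_ordering G l}"
    by (rule finite_subset[of _ "{..card (edges G)}"]) (auto simp: ms_ordering_le)
  show "{ms_ordering r G l | l. is_ordering G l} \<noteq> {}"
    using ex_bij_betw_finite_nat[OF simple_graph_finite_edges[OF assms]]
    by (auto simp: is_ordering_def)
qed

lemma simple_graph_complete_graph: "simple_graph (complete_graph n)"
  by (auto simp: simple_graph_def complete_graph_def)

end

theory Submission
  imports Defs
begin

text \<open>
  Upper bound: the degree sum allows at most \<open>r n / 2\<close> edges in a window, and equality would keep the
  sliding window \<open>r\<close>-regular, forcing the edge that enters to equal the edge that leaves.

  Lower bound: place all vertices but one, \<open>\<infinity>\<close>, on a circle of length \<open>n - 1\<close> and, following Walecki,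
  split the edges into \<open>n - 1\<close> classes of chords having a common axis of symmetry, each class being
  ordered by the distance of the ends from a point of the axis, its centre. Every vertex on the
  circle lies on exactly one edge of each class, and its position in the class is its rounded distance
  from the centre. A window is therefore \<open>(\<le> r)\<close>-regular as soon as the classes \<open>i\<close> and \<open>i + r\<close> have
  centres at distance at most \<open>1\<close> (when \<open>n\<close> and \<open>r\<close> are odd, at most \<open>1 / 2\<close>). Labels do not wrap
  around, so this only constrains the chains \<open>i, i + r, i + 2 r, \<dots>\<close>, and it suffices to arrange the
  chains one after the other along the circle.
\<close>

section \<open>Distance on a circle\<close>

text \<open>For positive \<open>K\<close>, the distance from \<open>x\<close> to the nearest
  multiple of \<open>K\<close>.\<close>

definition circ_dist :: "int \<Rightarrow> int \<Rightarrow> int" where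
  "circ_dist K x = min (x mod K) ((- x) mod K)"

lemma circ_dist_minus: "circ_dist K (- x) = circ_dist K x"
  by (simp add: circ_dist_def min.commute)

lemma circ_dist_cong: "x mod K = y mod K \<Longrightarrow> circ_dist K x = circ_dist K y"
  unfolding circ_dist_def by (metis mod_minus_cong)

lemma circ_dist_le:
  assumes "K > 0"
  shows "circ_dist K x \<le> \<bar>x - K * k\<bar>"
proof -
  have "circ_dist K x = circ_dist K (x - K * k)"
    by (rule circ_dist_cong) (use mod_mult_self2[of x K "- k"] in simp)
  moreover have "circ_dist K y \<le> \<bar>y\<bar>" for y
    using zmod_le_nonneg_dividend[of y K] zmod_le_nonneg_dividend[of "- y" K]
    unfolding circ_dist_def by linarith
  ultimately show ?thesis by metis
qed

text \<open>With \<open>circ_dist_le\<close> this presents \<open>circ_dist K x\<close> as the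
  minimum of \<open>\<bar>x - K * k\<bar>\<close> over \<open>k\<close>; the Lipschitz bound, the
  parity and the equality criterion are read off from that form.\<close>

lemma circ_dist_attained:
  assumes "K > 0"
  obtains k where "circ_dist K x = \<bar>x - K * k\<bar>"
proof (cases "x mod K \<le> (- x) mod K")
  case True
  have "\<bar>x - K * (x div K)\<bar> = x mod K"
    using assms by (simp add: minus_mult_div_eq_mod)
  with True that show ?thesis by (metis circ_dist_def min.absorb1)
next
  case False
  have "x - K * (- ((- x) div K)) = - ((- x) mod K)"
    using minus_mult_div_eq_mod[of "- x" K] by linarith
  then have "\<bar>x - K * (- ((- x) div K))\<bar> = (- x) mod K"
    using assms by simp
  with False that show ?thesis by (metis circ_dist_def min.absorb2 linear)
qed

lemma circ_dist_nonneg: "K > 0 \<Longrightarrow> 0 \<le> circ_dist K x"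
  by (simp add: circ_dist_def)

lemma circ_dist_lipschitz:
  assumes "K > 0"
  shows "circ_dist K x \<le> circ_dist K y + \<bar>x - y\<bar>"
proof -
  obtain k where "circ_dist K y = \<bar>y - K * k\<bar>"
    using circ_dist_attained[OF assms] .
  with circ_dist_le[OF assms, of x k] show ?thesis by linarith
qed

lemma circ_dist_le_half:
  assumes "K > 0"
  shows "2 * circ_dist K x \<le> K"
proof (cases "x mod K = 0")
  case True
  with assms show ?thesis by (simp add: circ_dist_def)
next
  case False
  then have "(- x) mod K = K - x mod K"
    by (simp add: zmod_zminus1_eq_if)
  then show ?thesis unfolding circ_dist_def by linarith
qed

lemma even_circ_dist:
  assumes "K > 0" "even K"
  shows "even (circ_dist K x) = even x"
proof -
  obtain k where "circ_dist K x = \<bar>x - K * k\<bar>"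
    using circ_dist_attained[OF assms(1)] .
  with assms(2) show ?thesis by simp
qed

lemma circ_dist_eqD:
  assumes "K > 0" "circ_dist K x = circ_dist K y"
  shows "K dvd x - y \<or> K dvd x + y"
proof -
  obtain k where k: "circ_dist K x = \<bar>x - K * k\<bar>"
    using circ_dist_attained[OF assms(1)] .
  obtain l where l: "circ_dist K y = \<bar>y - K * l\<bar>"
    using circ_dist_attained[OF assms(1)] .
  from k l assms(2) consider "x - K * k = y - K * l" | "x - K * k = - (y - K * l)"
    by linarith
  then show ?thesis
  proof cases
    case 1
    then have "x - y = K * (k - l)" by (simp add: algebra_simps)
    then show ?thesis by simp
  next
    case 2
    then have "x + y = K * (k + l)" by (simp add: algebra_simps)
    then show ?thesis by simp
  qed
qed

section \<open>Arranging residue classes as intervals\<close>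

lemma mono_block_unique:
  fixes S :: "nat \<Rightarrow> nat"
  assumes "mono S" "S i \<le> t" "t < S (Suc i)" "S j \<le> t" "t < S (Suc j)"
  shows "i = j"
proof (rule ccontr)
  assume "i \<noteq> j"
  then consider "Suc i \<le> j" | "Suc j \<le> i" by linarith
  then show False
    by cases (use monoD[OF assms(1)] assms in \<open>fastforce dest: order.trans\<close>)+
qed

text \<open>The residue classes modulo \<open>r\<close> become consecutive intervals, traversed alternately upwards and
  downwards, so that \<open>i\<close> and \<open>i + r\<close> are sent to neighbours.\<close>

lemma snake_bij:
  fixes r N :: nat and S \<kappa> :: "nat \<Rightarrow> nat"
  assumes "0 < r" "mono S" "S r = N"
    and kap: "\<And>c. c < r \<Longrightarrow> \<kappa> c < r" "inj_on \<kappa> {..<r}"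
    and len: "\<And>p. p < N \<Longrightarrow> S (\<kappa> (p mod r)) + p div r < S (Suc (\<kappa> (p mod r)))"
  defines "f \<equiv> \<lambda>p. let k = \<kappa> (p mod r); a = p div r in if even k then S k + a else S (Suc k) - 1 - a"
  shows "bij_betw f {..<N} {..<N}"
    and "\<And>i. i + r < N \<Longrightarrow> \<bar>int (f (i + r)) - int (f i)\<bar> = 1"
proof -
  have blk: "S (\<kappa> (p mod r)) \<le> f p \<and> f p < S (Suc (\<kappa> (p mod r)))" if "p < N" for p
    using len[OF that] by (auto simp: f_def Let_def)
  \<comment> \<open>The interval containing \<open>f p\<close> determines the residue of
    \<open>p\<close>, and the offset inside it determines the quotient.\<close>
  have inj: "inj_on f {..<N}"
  proof (rule inj_onI)
    fix p p' assume p: "p \<in> {..<N}" "p' \<in> {..<N}" and eq: "f p = f p'"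
    have "\<kappa> (p mod r) = \<kappa> (p' mod r)"
      using mono_block_unique[OF \<open>mono S\<close>] blk p eq by (metis lessThan_iff)
    moreover from this have c: "p mod r = p' mod r"
      using kap(2) \<open>0 < r\<close> by (auto dest: inj_onD)
    ultimately have "p div r = p' div r"
      using eq len[of p] len[of p'] p by (auto simp: f_def Let_def split: if_splits)
    with c show "p = p'" by (metis div_mult_mod_eq)
  qed
  have "f p < N" if "p < N" for p
  proof -
    have "S (Suc (\<kappa> (p mod r))) \<le> S r"
      by (rule monoD[OF \<open>mono S\<close>]) (use kap(1) \<open>0 < r\<close> in \<open>simp add: Suc_leI\<close>)
    with blk[OF that] \<open>S r = N\<close> show ?thesis by linarith
  qed
  then have "f ` {..<N} \<subseteq> {..<N}" by auto
  with inj show "bij_betw f {..<N} {..<N}"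
    by (simp add: bij_betw_def endo_inj_surj)
  fix i assume "i + r < N"
  then show "\<bar>int (f (i + r)) - int (f i)\<bar> = 1"
    using len[of i] len[of "i + r"] \<open>0 < r\<close> by (auto simp: f_def Let_def)
qed

text \<open>The parity clause serves odd \<open>n\<close> and odd \<open>r\<close>, where even
  classes must be centred at vertices of the circle and odd classes halfway between two
  vertices.\<close>

lemma ex_snake:
  fixes r N :: nat
  assumes "0 < r"
  obtains f where "bij_betw f {..<N} {..<N}"
    and "\<And>i. i + r < N \<Longrightarrow> \<bar>int (f (i + r)) - int (f i)\<bar> = 1"
    and "\<And>i. even N \<Longrightarrow> odd r \<Longrightarrow> i < N \<Longrightarrow> even (f i) = even i"
proof -
  define q c0 where "q = N div r" and "c0 = N mod r"
  have N: "N = q * r + c0" and c0: "c0 < r"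
    using assms by (auto simp: q_def c0_def)
  \<comment> \<open>The residues are listed upwards or downwards according to the parity of \<open>q\<close> so that, for even \<open>N\<close>
    and odd \<open>r\<close>, every second interval begins at an even number.\<close>
  define S where "S = (\<lambda>k. q * k + (if even q then min k c0 else k - (r - c0)))"
  define \<kappa> where "\<kappa> = (\<lambda>c. if even q then c else r - 1 - c)"
  define f where "f = (\<lambda>p. let k = \<kappa> (p mod r); a = p div r in
    if even k then S k + a else S (Suc k) - 1 - a)"
  have S: "mono S" "S r = N"
    using c0 by (auto simp: S_def N mono_iff_le_Suc)
  have kap: "\<kappa> c < r" if "c < r" for c using that by (auto simp: \<kappa>_def)
  have inj: "inj_on \<kappa> {..<r}" by (auto simp: \<kappa>_def inj_on_def)
  \<comment> \<open>Residue \<open>c\<close> has \<open>q + 1\<close> members below \<open>N\<close>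
    if \<open>c < c0\<close> and \<open>q\<close> otherwise; the intervals cut out by
    \<open>S\<close> have these lengths, the long ones first for even \<open>q\<close> and last for
    odd \<open>q\<close>.\<close>
  have len: "S (\<kappa> (p mod r)) + p div r < S (Suc (\<kappa> (p mod r)))" if "p < N" for p
  proof -
    define a c where "a = p div r" and "c = p mod r"
    have p: "p = a * r + c" and c: "c < r" using assms by (auto simp: a_def c_def)
    have "a \<le> q" unfolding a_def q_def using that by (simp add: div_le_mono)
    moreover have "c < c0" if "a = q" using \<open>p < N\<close> that p N by simp
    ultimately have "a < q \<or> a = q \<and> c < c0" by linarith
    then show ?thesis using c c0
      by (auto simp: S_def \<kappa>_def simp flip: a_def c_def)
  qed
  have par: "even (f p) = even p" if "even N" "odd r" "p < N" for p
  proof -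
    \<comment> \<open>Here \<open>c0\<close> has the parity of \<open>q\<close>, so the leading run
      of equal intervals, \<open>c0\<close> long or \<open>r - c0\<close> short ones, is even in
      number.\<close>
    have Sev: "even (S k)" if "even k" for k
      using that \<open>even N\<close> \<open>odd r\<close> c0 N by (auto simp: S_def min_def)
    define a c where "a = p div r" and "c = p mod r"
    have p: "p = a * r + c" and c: "c < r" using assms by (auto simp: a_def c_def)
    have kc: "even (\<kappa> c) = even c" using c \<open>odd r\<close> by (auto simp: \<kappa>_def)
    have lt: "S (\<kappa> c) + a < S (Suc (\<kappa> c))"
      using len[OF \<open>p < N\<close>] by (simp add: a_def c_def)
    show ?thesis
    proof (cases "even (\<kappa> c)")
      case True
      then have "f p = S (\<kappa> c) + a" by (simp add: f_def a_def c_def)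
      with True kc Sev p \<open>odd r\<close> show ?thesis by simp
    next
      case False
      \<comment> \<open>A descending interval is counted from its right end, which is even because
        \<open>\<kappa> c\<close> is odd. Owing to the alternation only even-numbered boundaries
        have to be even.\<close>
      then have "f p + 1 + a = S (Suc (\<kappa> c))"
        using lt by (simp add: f_def a_def c_def)
      moreover have "even (S (Suc (\<kappa> c)))" using False Sev by simp
      ultimately have "even (f p + 1 + a)" by simp
      with False kc p \<open>odd r\<close> show ?thesis by simp
    qed
  qed
  show ?thesis
    by (rule that[of f]) (use snake_bij[OF assms S kap inj len] par in \<open>simp_all add: f_def\<close>)
qed

section \<open>Upper bound by degree sums\<close>

lemma sum_degree:
  assumes "finite V" "finite E" "\<forall>e\<in>E. e \<subseteq> V \<and> card e = 2"
  shows "(\<Sum>v\<in>V. degree (V, E) v) = 2 * card E"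
proof -
  have "(\<Sum>v\<in>V. degree (V, E) v) = (\<Sum>v\<in>V. \<Sum>e\<in>E. if v \<in> e then 1 else 0)"
    using assms(2) by (intro sum.cong) (auto simp: degree_def simp flip: sum.inter_filter)
  also have "\<dots> = (\<Sum>e\<in>E. \<Sum>v\<in>V. if v \<in> e then 1 else 0)"
    by (rule sum.swap)
  also have "\<dots> = (\<Sum>e\<in>E. card {v \<in> V. v \<in> e})"
    using assms(1) by (intro sum.cong) (auto simp flip: sum.inter_filter)
  also have "\<dots> = (\<Sum>e\<in>E. 2)"
  proof (rule sum.cong)
    fix e assume "e \<in> E"
    with assms(3) have "{v \<in> V. v \<in> e} = e" "card e = 2" by auto
    then show "card {v \<in> V. v \<in> e} = 2" by simp
  qed simp
  finally show ?thesis by simp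
qed

lemma card_edges_complete_graph: "card (edges (complete_graph n)) = n * (n - 1) div 2"
  using n_subsets[of "{0..<n}" 2] by (simp add: complete_graph_def choose_two)

lemma card_window:
  assumes "is_ordering G l" "i + s \<le> card (edges G)"
  shows "card (edges (window G l i s)) = s"
proof -
  have bij: "bij_betw l (edges G) {0..<card (edges G)}"
    using assms(1) by (simp add: is_ordering_def)
  have "l ` edges (window G l i s) = {i..<i + s}"
  proof
    show "{i..<i + s} \<subseteq> l ` edges (window G l i s)"
    proof
      fix t assume t: "t \<in> {i..<i + s}"
      with assms(2) have "t \<in> l ` edges G"
        using bij_betw_imp_surj_on[OF bij] by auto
      with t show "t \<in> l ` edges (window G l i s)" by (auto simp: window_def)
    qed
  qed (auto simp: window_def)
  moreover have "inj_on l (edges (window G l i s))"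
    by (rule inj_on_subset[OF bij_betw_imp_inj_on[OF bij]]) (auto simp: window_def)
  ultimately show ?thesis
    by (metis card_image card_atLeastLessThan add_diff_cancel_left')
qed

lemma ms_ordering_complete_graph_less:
  assumes "0 < r" "r + 2 \<le> n" "is_ordering (complete_graph n) l"
  shows "2 * ms_ordering r (complete_graph n) l < r * n"
proof (rule ccontr)
  let ?G = "complete_graph n"
  define s where "s = ms_ordering r ?G l"
  assume "\<not> 2 * ms_ordering r ?G l < r * n"
  then have ge: "r * n \<le> 2 * s" by (simp add: s_def)
  have "s \<in> {s. s \<le> card (edges ?G) \<and>
     (\<forall>i. i + s \<le> card (edges ?G) \<longrightarrow> le_regular r (window ?G l i s))}"
    unfolding s_def ms_ordering_def using ms_ordering_set[of ?G r l] by (intro Max_in) blast+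
  then have s: "s \<le> card (edges ?G)"
    and reg: "\<And>i. i + s \<le> card (edges ?G) \<Longrightarrow> le_regular r (window ?G l i s)"
    by auto
  have bij: "bij_betw l (edges ?G) {0..<card (edges ?G)}"
    using assms(3) by (simp add: is_ordering_def)
  have fin: "finite (edges ?G)"
    by (rule simple_graph_finite_edges[OF simple_graph_complete_graph])
  have sum_deg: "(\<Sum>v\<in>{0..<n}. degree (window ?G l i s) v) = 2 * s"
    if "i + s \<le> card (edges ?G)" for i
  proof -
    have "(\<Sum>v\<in>{0..<n}. degree ({0..<n}, edges (window ?G l i s)) v) = 2 * card (edges (window ?G l i s))"
      using fin by (intro sum_degree) (auto simp: window_def complete_graph_def)
    moreover have "({0..<n}, edges (window ?G l i s)) = window ?G l i s"
      by (simp add: window_def complete_graph_def)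
    ultimately show ?thesis using card_window[OF assms(3) that] by simp
  qed
  have deg_le: "degree (window ?G l i s) v \<le> r" if "i + s \<le> card (edges ?G)" "v < n" for i v
    using reg[OF that(1)] that(2) by (auto simp: le_regular_def window_def complete_graph_def)
  have "2 * s \<le> (\<Sum>v\<in>{0..<n}. r)"
    unfolding sum_deg[of 0, simplified, OF s, symmetric] using s
    by (intro sum_mono) (auto intro: deg_le)
  with ge have s_eq: "2 * s = n * r" by (simp add: mult.commute)
  have deg_eq: "degree (window ?G l i s) v = r" if "i + s \<le> card (edges ?G)" "v < n" for i v
  proof (rule ccontr)
    assume "degree (window ?G l i s) v \<noteq> r"
    with deg_le[OF that] have "degree (window ?G l i s) v < r" by simp
    then have "(\<Sum>v\<in>{0..<n}. degree (window ?G l i s) v) < (\<Sum>v\<in>{0..<n}. r)"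
      using that deg_le by (intro sum_strict_mono_ex1) auto
    then show False using sum_deg[OF that(1)] s_eq by simp
  qed
  \<comment> \<open>The bound \<open>r + 2 \<le> n\<close> leaves room for a second window, starting
    at label 1.\<close>
  have "n * r + 2 \<le> n * (r + 1)" using assms by simp
  also have "\<dots> \<le> n * (n - 1)" using assms by (intro mult_le_mono) auto
  finally have "s + 1 \<le> n * (n - 1) div 2" using s_eq by linarith
  then have s1: "1 + s \<le> card (edges ?G)"
    by (simp add: card_edges_complete_graph)
  \<comment> \<open>Moving the window from 0 to 1 drops \<open>e\<close> and admits
    \<open>e'\<close>; an end \<open>v\<close> of \<open>e\<close> that is not on \<open>e'\<close>
    loses a degree.\<close>
  from s1 have "0 \<in> l ` edges ?G" "s \<in> l ` edges ?G"
    unfolding bij_betw_imp_surj_on[OF bij] by auto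
  then obtain e e' where e: "e \<in> edges ?G" "l e = 0" and e': "e' \<in> edges ?G" "l e' = s"
    by auto
  have "0 < n * r" using assms by simp
  with s_eq have "0 < s" by linarith
  then have "e \<noteq> e'" using e e' by auto
  moreover have "card e = 2" "card e' = 2" "finite e'" and en: "e \<subseteq> {0..<n}"
    using e e' by (auto simp: complete_graph_def intro: card_ge_0_finite)
  ultimately obtain v where v: "v \<in> e" "v \<notin> e'"
    by (metis card_subset_eq subsetI)
  let ?D = "\<lambda>i. {f \<in> edges (window ?G l i s). v \<in> f}"
  have "?D 1 \<subseteq> ?D 0 - {e}"
  proof
    fix f assume "f \<in> ?D 1"
    then have f: "f \<in> edges ?G" "v \<in> f" "1 \<le> l f" "l f < 1 + s"
      by (auto simp: window_def)
    have "f \<noteq> e'" using f v by auto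
    then have "l f \<noteq> s" using f e' bij_betw_imp_inj_on[OF bij] by (metis inj_onD)
    with f e show "f \<in> ?D 0 - {e}" by (auto simp: window_def)
  qed
  moreover have "finite (?D 0)" using fin by (auto simp: window_def)
  moreover have "e \<in> ?D 0" using e v \<open>0 < s\<close> by (auto simp: window_def)
  ultimately have "card (?D 1) < card (?D 0)"
    by (intro psubset_card_mono) auto
  then show False
    using deg_eq[of 0 v] deg_eq[of 1 v] s s1 v en by (auto simp: degree_def)
qed

section \<open>From labels at the vertices to an ordering\<close>

lemma le_msI:
  assumes "simple_graph G" "is_ordering G l" "s \<le> card (edges G)"
    and "\<And>i. i + s \<le> card (edges G) \<Longrightarrow> le_regular r (window G l i s)"
  shows "s \<le> ms r G"
proof -
  have "s \<le> ms_ordering r G l"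
    unfolding ms_ordering_def using assms(3,4) ms_ordering_set(1) by (intro Max_ge) auto
  also have "\<dots> \<le> ms r G"
    unfolding ms_def using assms(2) ms_set(1)[OF assms(1)] by (intro Max_ge) auto
  finally show ?thesis .
qed

text \<open>If \<open>a\<close> is the least index with a value in the window, the value at
  \<open>a + r\<close> has already passed the window, and monotonicity excludes all later indices.
  Applied to the labels at a vertex, this bounds its degree.\<close>

lemma card_mono_hits_le:
  fixes T :: "nat \<Rightarrow> nat"
  assumes mono: "\<And>i j. i \<le> j \<Longrightarrow> j < N \<Longrightarrow> T i \<le> T j"
    and gap: "\<And>i. i + r < N \<Longrightarrow> T i + s \<le> T (i + r)"
  shows "card {i. i < N \<and> T i \<in> {w..<w + s}} \<le> r"
proof (cases "{i. i < N \<and> T i \<in> {w..<w + s}} = {}")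
  case False
  let ?A = "{i. i < N \<and> T i \<in> {w..<w + s}}"
  define a where "a = Min ?A"
  have a: "a \<in> ?A" unfolding a_def using False by (intro Min_in) auto
  have "?A \<subseteq> {a..<a + r}"
  proof
    fix i assume i: "i \<in> ?A"
    then have "a \<le> i" unfolding a_def by (intro Min_le) auto
    moreover have "i < a + r"
    proof (rule ccontr)
      assume "\<not> i < a + r"
      then have "a + r \<le> i" "a + r < N" using i by auto
      with mono[of "a + r" i] gap[of a] i a show False by auto
    qed
    ultimately show "i \<in> {a..<a + r}" by simp
  qed
  from card_mono[OF _ this] show ?thesis by simp
next
  case True
  then show ?thesis by (metis card.empty le0)
qed

text \<open>\<open>T v i\<close> is the label of the \<open>i\<close>-th edge at \<open>v\<close>.\<close>

lemma le_ms_complete_graph_if_labels: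
  fixes T :: "nat \<Rightarrow> nat \<Rightarrow> nat"
  assumes "s \<le> n * (n - 1) div 2"
    and mono: "\<And>v i j. v < n \<Longrightarrow> i \<le> j \<Longrightarrow> j < N \<Longrightarrow> T v i \<le> T v j"
    and gap: "\<And>v i. v < n \<Longrightarrow> i + r < N \<Longrightarrow> T v i + s \<le> T v (i + r)"
    and bound: "\<And>v i. v < n \<Longrightarrow> i < N \<Longrightarrow> T v i < n * (n - 1) div 2"
    and meet: "\<And>u v. u < v \<Longrightarrow> v < n \<Longrightarrow> \<exists>i<N. \<exists>j<N. T u i = T v j"
    and two: "\<And>t. card {v. v < n \<and> t \<in> T v ` {..<N}} \<le> 2"
  shows "s \<le> ms r (complete_graph n)"
proof -
  let ?G = "complete_graph n"
  have E: "e \<in> edges ?G \<longleftrightarrow> e \<subseteq> {0..<n} \<and> card e = 2" for e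
    by (simp add: complete_graph_def)
  \<comment> \<open>By \<open>meet\<close> the two ends of an edge do share a label.\<close>
  define l where "l e = (SOME t. \<forall>v\<in>e. t \<in> T v ` {..<N})" for e
  have l: "l e \<in> T v ` {..<N}" if e: "e \<in> edges ?G" and v: "v \<in> e" for e v
  proof -
    obtain x y where "e = {x, y}" "x \<noteq> y" "x < n" "y < n"
      using e unfolding E card_2_iff by auto
    then obtain x y where xy: "e = {x, y}" "x < y" "y < n"
      by (metis insert_commute linorder_neqE_nat)
    from meet[OF xy(2,3)] have "\<exists>t. \<forall>v\<in>e. t \<in> T v ` {..<N}"
      unfolding xy(1) by auto
    from someI_ex[OF this] show ?thesis using v by (auto simp: l_def)
  qed
  have inj: "inj_on l (edges ?G)"
  proof (rule inj_onI)
    fix e e' assume e: "e \<in> edges ?G" and e': "e' \<in> edges ?G" and eq: "l e = l e'"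
    \<comment> \<open>By \<open>two\<close> the set of vertices carrying a given label is no larger
      than an edge, so the label determines the edge.\<close>
    let ?A = "{v. v < n \<and> l e \<in> T v ` {..<N}}"
    have "e \<subseteq> ?A" "e' \<subseteq> ?A" using e e' eq l[OF e] l[OF e'] by (auto simp: E)
    moreover have "finite ?A" by simp
    ultimately show "e = e'" using two[of "l e"] e e' unfolding E
      by (metis card_seteq)
  qed
  have "l ` edges ?G \<subseteq> {0..<card (edges ?G)}"
  proof
    fix t assume "t \<in> l ` edges ?G"
    then obtain e where e: "e \<in> edges ?G" "t = l e" by auto
    then obtain v where "v \<in> e" "v < n" unfolding E
      by (metis atLeastLessThan_iff card.empty ex_in_conv subsetD zero_neq_numeral)
    from l[OF e(1) this(1)] obtain i where "i < N" "t = T v i" using e by auto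
    with bound \<open>v < n\<close> show "t \<in> {0..<card (edges ?G)}"
      by (simp add: card_edges_complete_graph)
  qed
  then have "l ` edges ?G = {0..<card (edges ?G)}"
    using inj by (intro card_subset_eq) (auto simp: card_image)
  with inj have ord: "is_ordering ?G l"
    by (simp add: is_ordering_def bij_betw_def)
  show ?thesis
  proof (rule le_msI[OF simple_graph_complete_graph ord])
    show "s \<le> card (edges ?G)" using assms(1) by (simp add: card_edges_complete_graph)
    fix w
    show "le_regular r (window ?G l w s)"
      unfolding le_regular_def
    proof
      fix v assume "v \<in> verts (window ?G l w s)"
      then have v: "v < n" by (simp add: window_def complete_graph_def)
      let ?D = "{e \<in> edges (window ?G l w s). v \<in> e}"
      let ?I = "{i. i < N \<and> T v i \<in> {w..<w + s}}"
      have "l ` ?D \<subseteq> T v ` ?I"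
        using l by (fastforce simp: window_def)
      then have "card (l ` ?D) \<le> card (T v ` ?I)" by (intro card_mono) auto
      also have "\<dots> \<le> card ?I" by (intro card_image_le) auto
      also have "\<dots> \<le> r"
        using mono[OF v] gap[OF v] by (rule card_mono_hits_le)
      finally have "card (l ` ?D) \<le> r" .
      moreover have "inj_on l ?D"
        by (rule inj_on_subset[OF inj]) (auto simp: window_def)
      ultimately show "degree (window ?G l w s) v \<le> r"
        by (simp add: degree_def card_image)
    qed
  qed
qed

section \<open>Choice of the centres\<close>

text \<open>Class number \<open>i\<close> is centred at the point \<open>h i / 2\<close> of the circle of length \<open>n - 1\<close>.\<close>

lemma ex_half_centres:
  fixes n r :: nat
  assumes "3 \<le> n" "0 < r"
  obtains h :: "nat \<Rightarrow> nat"
  where "\<And>i. i < n - 1 \<Longrightarrow> even (h i) \<longleftrightarrow> even n \<or> even i"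
    and "\<And>i. i + r < n - 1 \<Longrightarrow> \<bar>int (h (i + r)) - int (h i)\<bar> \<le> 2"
    and "\<And>k. k < n - 1 \<Longrightarrow> (if even n then 2 * k else k) \<in> h ` {..<n - 1}"
proof -
  consider (even) "even n" | (odd_odd) "odd n" "odd r" | (odd_even) "odd n" "even r" by blast
  then show ?thesis
  proof cases
    case even
    \<comment> \<open>The circle has odd length, so each axis of symmetry meets exactly one vertex,
      which is taken as the centre; hence the doubling.\<close>
    obtain f where f: "bij_betw f {..<n - 1} {..<n - 1}"
      "\<And>i. i + r < n - 1 \<Longrightarrow> \<bar>int (f (i + r)) - int (f i)\<bar> = 1"
      using ex_snake[OF assms(2), of "n - 1"] by metis
    have "2 * k \<in> (\<lambda>i. 2 * f i) ` {..<n - 1}" if "k < n - 1" for k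
    proof -
      have "k \<in> f ` {..<n - 1}" using f(1) that by (simp add: bij_betw_def)
      then show ?thesis by auto
    qed
    moreover have "\<bar>int (2 * f (i + r)) - int (2 * f i)\<bar> \<le> 2" if "i + r < n - 1" for i
      using f(2)[OF that] by simp
    ultimately show ?thesis using even by (intro that[of "\<lambda>i. 2 * f i"]) auto
  next
    case odd_odd
    \<comment> \<open>The snake itself serves as \<open>h\<close>: its steps of 1 move the centre by
      half a unit.\<close>
    obtain f where f: "bij_betw f {..<n - 1} {..<n - 1}"
      "\<And>i. i + r < n - 1 \<Longrightarrow> \<bar>int (f (i + r)) - int (f i)\<bar> = 1"
      "\<And>i. even (n - 1) \<Longrightarrow> odd r \<Longrightarrow> i < n - 1 \<Longrightarrow> even (f i) = even i"
      using ex_snake[OF assms(2), of "n - 1"] by metis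
    have "even (n - 1)" using odd_odd by simp
    with f odd_odd show ?thesis by (intro that[of f]) (auto simp: bij_betw_def)
  next
    case odd_even
    define m where "m = (n - 1) div 2"
    have m: "n - 1 = 2 * m" using odd_even by (simp add: m_def)
    obtain q where q: "r = 2 * q" "0 < q" using odd_even assms(2) by (auto elim!: evenE)
    obtain f where f: "bij_betw f {..<m} {..<m}"
      "\<And>i. i + q < m \<Longrightarrow> \<bar>int (f (i + q)) - int (f i)\<bar> = 1"
      using ex_snake[OF q(2), of m] by metis
    \<comment> \<open>Classes are taken in pairs \<open>2 * j\<close>, \<open>2 * j + 1\<close>, and
      the pairs follow a snake of step \<open>q\<close>. Adding the even number \<open>r\<close>
      keeps the place within the pair, so the centre moves by one unit.\<close>
    define h where "h i = 2 * f (i div 2) + i mod 2" for i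
    have "even (h i) \<longleftrightarrow> even i" for i by (simp add: h_def)
    moreover have "\<bar>int (h (i + r)) - int (h i)\<bar> \<le> 2" if "i + r < n - 1" for i
    proof -
      have "i div 2 + q < m" using that m q by linarith
      from f(2)[OF this] show ?thesis by (simp add: h_def q add.commute)
    qed
    moreover have "k \<in> h ` {..<n - 1}" if "k < n - 1" for k
    proof -
      have "k div 2 < m" using that m by linarith
      then have "k div 2 \<in> f ` {..<m}" using f(1) by (simp add: bij_betw_def)
      then obtain i where i: "i < m" "f i = k div 2" by auto
      have "h (2 * i + k mod 2) = k" by (simp add: h_def i)
      moreover have "2 * i + k mod 2 < n - 1" using i m by linarith
      ultimately show ?thesis by (metis image_eqI lessThan_iff)
    qed
    ultimately show ?thesis using odd_even by (intro that[of h]) auto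
  qed
qed

section \<open>Labelling the Walecki classes\<close>

text \<open>The parities make the two labels exactly \<open>(x + d) / 2\<close> and
  \<open>(x + y + d') / 2\<close>, so \<open>d - d'\<close> may be at most 2 for even
  \<open>y\<close> and at most 1 for odd \<open>y\<close>. In the latter case \<open>d\<close> and
  \<open>d'\<close> differ in parity, which sharpens 2 to 1.\<close>

lemma half_gap_le:
  fixes x y d d' :: nat
  assumes "even d = even x" "even d' \<longleftrightarrow> (even x = even y)" "d \<le> d' + 2" "0 < y"
  shows "(x + 1) div 2 + d div 2 + (y - 1) div 2 \<le> (x + y + 1) div 2 + d' div 2"
proof (cases "even x"; cases "even y")
  assume p: "even x" "even y"
  with assms have "even d" "even d'" by auto
  with p assms(3,4) show ?thesis by (auto elim!: evenE)
next
  assume p: "even x" "odd y"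
  with assms have "even d" "odd d'" by auto
  with p assms(3,4) show ?thesis by (auto elim!: evenE oddE)
next
  assume p: "odd x" "even y"
  with assms have "odd d" "odd d'" by auto
  with p assms(3,4) show ?thesis by (auto elim!: evenE oddE)
next
  assume p: "odd x" "odd y"
  with assms have "odd d" "even d'" by auto
  with p assms(3,4) show ?thesis by (auto elim!: evenE oddE)
qed

text \<open>Here \<open>surj\<close> provides a class for every chord, \<open>step\<close> gives the
  gap between labels \<open>r\<close> classes apart, and \<open>par\<close> makes the positions in a
  class fit its block of labels.\<close>

lemma le_ms_complete_graph:
  fixes n r :: nat and h :: "nat \<Rightarrow> nat"
  assumes "3 \<le> n" "0 < r" "r + 2 \<le> n"
    and par: "\<And>i. i < n - 1 \<Longrightarrow> even (h i) \<longleftrightarrow> even n \<or> even i"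
    and step: "\<And>i. i + r < n - 1 \<Longrightarrow> \<bar>int (h (i + r)) - int (h i)\<bar> \<le> 2"
    and surj: "\<And>k. k < n - 1 \<Longrightarrow> (if even n then 2 * k else k) \<in> h ` {..<n - 1}"
  shows "(r * n - 1) div 2 \<le> ms r (complete_graph n)"
proof -
  \<comment> \<open>The vertex \<open>M\<close> plays the role of \<open>\<infinity>\<close>; class \<open>i\<close> occupies the labels from \<open>S i\<close> to \<open>S (i + 1) - 1\<close>.
    If \<open>n\<close> is odd then \<open>\<infinity>\<close> lies on both the first and the last edge of every even class and
    misses the odd classes.\<close>
  define M where "M = n - 1"
  \<comment> \<open>Doubled lengths make the centres \<open>h i / 2\<close> integral:
    \<open>D i v\<close> is twice the distance from \<open>v\<close> to the centre of class
    \<open>i\<close> on the circle of length \<open>M\<close>.\<close>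
  define K where "K = 2 * int M"
  define D where "D i v = nat (circ_dist K (2 * int v - int (h i)))" for i v
  define S where "S i = (i * n + 1) div 2" for i
  define T where "T v i = (if v < M then S i + D i v div 2 else i * n div 2)" for v i
  have M: "2 \<le> M" "n = M + 1" using assms(1) by (auto simp: M_def)
  have K: "0 < K" "even K" using M by (auto simp: K_def)
  have D_eq: "int (D i v) = circ_dist K (2 * int v - int (h i))" for i v
    using circ_dist_nonneg[OF K(1)] by (simp add: D_def)
  have D_le: "D i v \<le> M" for i v
    using circ_dist_le_half[OF K(1), of "2 * int v - int (h i)"]
    unfolding D_eq[symmetric] unfolding K_def by simp
  have D_par: "even (D i v) \<longleftrightarrow> even n \<or> even i" if "i < M" for i v
  proof -
    have "even (int (D i v)) \<longleftrightarrow> even (h i)"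
      unfolding D_eq even_circ_dist[OF K] by simp
    with par[of i] that show ?thesis by (simp add: M_def)
  qed
  have S_mono: "mono S"
    by (auto simp: S_def mono_def intro!: div_le_mono)
  \<comment> \<open>Given its parity and \<open>D i v \<le> M\<close>, \<open>D i v\<close> has as
    many possible values as the block has labels: \<open>n / 2\<close> for even \<open>n\<close>,
    and for odd \<open>n\<close> either \<open>(n + 1) / 2\<close> (even \<open>i\<close>) or
    \<open>(n - 1) / 2\<close> (odd \<open>i\<close>).\<close>
  have block: "S i + D i v div 2 < S (Suc i)" if "i < M" for i v
  proof -
    define x where "x = i * n"
    have "even x \<longleftrightarrow> even n \<or> even i" by (auto simp: x_def)
    with D_par[OF that, of v] have "even (D i v) = even x" "even n \<longrightarrow> even x" by auto
    with D_le[of i v] M(2) have "(x + 1) div 2 + D i v div 2 < (n + x + 1) div 2"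
      by presburger
    then show ?thesis by (simp add: S_def x_def)
  qed
  have S_last: "S M = n * (n - 1) div 2"
  proof -
    have "even (M * n)" using M by simp
    then have "S M = M * n div 2" unfolding S_def by presburger
    then show ?thesis by (simp add: M_def mult.commute)
  qed
  have dvd_iff: "K dvd 2 * x \<longleftrightarrow> int M dvd x" for x by (simp add: K_def)
  have eq_if_dvd: "u = v" if "int M dvd int u - int v" "u < M" "v < M" for u v
    using that by (metis mod_eq_dvd_iff mod_less of_nat_eq_iff zmod_int)
  show ?thesis
  proof (rule le_ms_complete_graph_if_labels[where T = T and N = M])
    have "r * n \<le> M * n" using assms(3) by (intro mult_le_mono) (auto simp: M_def)
    then have "r * n - 1 \<le> M * n" by linarith
    then have "(r * n - 1) div 2 \<le> M * n div 2" by (rule div_le_mono)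
    then show "(r * n - 1) div 2 \<le> n * (n - 1) div 2" by (simp add: M_def mult.commute)
  next
    fix v i j assume ij: "i \<le> j" "j < M"
    show "T v i \<le> T v j"
    proof (cases "i = j")
      case False
      with ij have "S (Suc i) \<le> S j" by (intro monoD[OF S_mono]) simp
      with block[of i v] ij show ?thesis by (auto simp: T_def intro: div_le_mono)
    qed simp
  next
    fix v i assume i: "i + r < M"
    define x y where "x = i * n" and "y = r * n"
    have y: "0 < y" using assms by (simp add: y_def)
    show "T v i + (r * n - 1) div 2 \<le> T v (i + r)"
    proof (cases "v < M")
      case True
      have "int (D i v) \<le> int (D (i + r) v) + 2"
        unfolding D_eq using circ_dist_lipschitz[OF K(1), of "2 * int v - int (h i)" "2 * int v - int (h (i + r))"]
          step[of i] i by (simp add: M_def)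
      then have le: "D i v \<le> D (i + r) v + 2" by simp
      have "even (D i v) = even x" "even (D (i + r) v) \<longleftrightarrow> (even x = even y)"
        using D_par[of i v] D_par[of "i + r" v] i by (auto simp: x_def y_def)
      from half_gap_le[OF this(1,2) le y]
      have "(x + 1) div 2 + D i v div 2 + (y - 1) div 2 \<le> (x + y + 1) div 2 + D (i + r) v div 2" .
      with True show ?thesis by (simp add: T_def S_def x_def y_def add_mult_distrib)
    next
      case False
      have "x div 2 + (y - 1) div 2 \<le> (x + y) div 2" by presburger
      with False show ?thesis by (simp add: T_def x_def y_def add_mult_distrib)
    qed
  next
    fix v i assume i: "i < M"
    show "T v i < n * (n - 1) div 2"
    proof (cases "v < M")
      case True
      have "S (Suc i) \<le> S M" using i by (intro monoD[OF S_mono]) simp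
      with block[OF i, of v] True S_last show ?thesis by (simp add: T_def)
    next
      case False
      have "Suc i * n \<le> M * n" using i by (intro mult_le_mono) auto
      then have "i * n + 2 \<le> n * (n - 1)" using assms(1) by (simp add: M_def mult.commute)
      with False show ?thesis by (simp add: T_def)
    qed
  next
    fix u v assume uv: "u < v" "v < n"
    show "\<exists>i<M. \<exists>j<M. T u i = T v j"
    proof (cases "v < M")
      case True
      \<comment> \<open>The chord from \<open>u\<close> to \<open>v\<close> belongs to a class whose
        axis exchanges them, so \<open>h i\<close> must be congruent to \<open>u + v\<close> modulo
        \<open>M\<close>.\<close>
      have "\<exists>i<M. int M dvd int u + int v - int (h i)"
      proof (cases "even n")
        case True
        \<comment> \<open>Modulo \<open>M\<close>, \<open>n div 2\<close> is the inverse of 2, so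
          \<open>c\<close> is the midpoint of \<open>u\<close> and \<open>v\<close>.\<close>
        define c where "c = ((u + v) * (n div 2)) mod M"
        have "2 * (n div 2) = M + 1" using True M(2) by simp
        have "int (u + v) - int (2 * c) = int (u + v) - 2 * (int ((u + v) * (n div 2)) mod int M)"
          by (simp add: c_def zmod_int)
        moreover have "int M dvd int ((u + v) * (n div 2)) - int ((u + v) * (n div 2)) mod int M"
          by (simp add: minus_mod_eq_mult_div)
        then have "int M dvd 2 * (int ((u + v) * (n div 2)) - int ((u + v) * (n div 2)) mod int M)"
          by (rule dvd_mult)
        moreover have "2 * int ((u + v) * (n div 2)) = int (u + v) + int M * int (u + v)"
        proof -
          have "2 * ((u + v) * (n div 2)) = (u + v) * (2 * (n div 2))" by simp
          also have "\<dots> = (u + v) + M * (u + v)"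
            unfolding \<open>2 * (n div 2) = M + 1\<close> by (simp add: algebra_simps)
          finally show ?thesis by (metis of_nat_add of_nat_mult of_nat_numeral)
        qed
        ultimately have "int M dvd int (u + v) - int (2 * c) + int M * int (u + v)"
          by (simp add: algebra_simps)
        then have "int M dvd int (u + v) - int (2 * c)"
          by (metis dvd_add_left_iff dvd_triv_left)
        moreover have "c < M" using M by (simp add: c_def)
        then obtain i where "i < M" "h i = 2 * c"
          using surj[of c] True by (auto simp: M_def)
        ultimately show ?thesis by (auto intro!: exI[of _ i])
      next
        case False
        have "(u + v) mod M < M" using M by simp
        then obtain i where "i < M" "h i = (u + v) mod M"
          using surj[of "(u + v) mod M"] False by (auto simp: M_def)
        moreover have "int M dvd int (u + v) - int ((u + v) mod M)"
          by (simp add: zmod_int minus_mod_eq_mult_div)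
        ultimately show ?thesis by (auto intro!: exI[of _ i])
      qed
      then obtain i where i: "i < M" and dvd: "int M dvd int u + int v - int (h i)" by blast
      have "K dvd (2 * int u - int (h i)) - (int (h i) - 2 * int v)"
        using dvd unfolding dvd_iff[symmetric] by (simp add: algebra_simps)
      then have "(2 * int u - int (h i)) mod K = (- (2 * int v - int (h i))) mod K"
        by (simp add: mod_eq_dvd_iff)
      then have "D i u = D i v"
        unfolding D_def using circ_dist_cong circ_dist_minus by metis
      with True uv have "T u i = T v i" by (simp add: T_def)
      with i show ?thesis by blast
    next
      case False
      with uv M have v: "v = M" and u: "u < M" by auto
      show ?thesis
      proof (cases "even n \<or> 2 * u < M")
        case True
        \<comment> \<open>Here \<open>u\<close> is a centre, and its edge to \<open>M\<close> is the
          first of the class.\<close>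
        then obtain i where i: "i < M" "h i = 2 * u"
          using surj[of u] surj[of "2 * u"] u by (cases "even n") (auto simp: M_def)
        have "D i u = 0" by (simp add: D_def i circ_dist_def)
        moreover from this have "even (i * n)" using D_par[OF i(1), of u] by auto
        ultimately have "T u i = T v i" using u v by (simp add: T_def S_def)
        with i show ?thesis by blast
      next
        case False
        then have odd: "odd n" and ge: "M \<le> 2 * u" by auto
        \<comment> \<open>Otherwise \<open>u\<close> is the antipode of the centre
          \<open>(2 * u - M) / 2\<close>. Its edge to \<open>M\<close> is the last of the even class
          \<open>i\<close>, and this label is listed at \<open>M\<close> under index
          \<open>Suc i\<close>.\<close>
        have "2 * u - M < M" using u ge by linarith
        then have "2 * u - M \<in> h ` {..<M}"
          using surj[of "2 * u - M", folded M_def] odd by simp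
        then obtain i where i: "i < M" "h i = 2 * u - M" by auto
        have "2 * int u - int (h i) = int M" using ge i by simp
        then have "D i u = M" by (simp add: D_def circ_dist_def K_def zmod_zminus1_eq_if)
        moreover have "even M" using odd M by simp
        ultimately have "even i" using D_par[OF i(1), of u] odd by simp
        then have "even (i * n)" by simp
        then have "(i * n + 1) div 2 + M div 2 = (M + 1 + i * n) div 2"
          using \<open>even M\<close> by presburger
        with \<open>D i u = M\<close> M(2) have "T u i = T v (Suc i)"
          using u v by (simp add: T_def S_def)
        moreover have "Suc i < M" using \<open>even i\<close> \<open>even M\<close> i by presburger
        ultimately show ?thesis using i by blast
      qed
    qed
  next
    fix t
    define A where "A = {v. v < n \<and> t \<in> T v ` {..<M}}"
    have "finite A" by (simp add: A_def)
    show "card {v. v < n \<and> t \<in> T v ` {..<M}} \<le> 2"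
      unfolding A_def[symmetric]
    proof (cases "\<exists>u\<in>A. u < M")
      case False
      then have "A \<subseteq> {M}" using M by (auto simp: A_def)
      then have "card A \<le> card {M}" by (intro card_mono) auto
      then show "card A \<le> 2" by simp
    next
      case True
      then obtain u i where u: "u \<in> A" "u < M" and i: "i < M" "t = S i + D i u div 2"
        by (auto simp: A_def T_def)
      \<comment> \<open>Circle vertices with label \<open>t\<close> share the block \<open>i\<close>
        and, parity included, the distance to its centre; they coincide or are mirror
        images.\<close>
      have pair: "K dvd 2 * int u - 2 * int v \<or> int M dvd int u + int v - int (h i)"
        and same: "D i v = D i u"
        if v: "v \<in> A" "v < M" for v
      proof -
        from v obtain j where j: "j < M" "t = S j + D j v div 2" by (auto simp: A_def T_def)
        have "j = i"
          by (rule mono_block_unique[OF S_mono, where t = t])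
            (use block[OF j(1), of v] block[OF i(1), of u] i j in auto)
        then have "D i v div 2 = D i u div 2" using i j by simp
        moreover have "even (D i v) = even (D i u)" using D_par[OF i(1)] by simp
        ultimately show same: "D i v = D i u" by presburger
        then have "K dvd (2 * int u - int (h i)) - (2 * int v - int (h i)) \<or>
            K dvd (2 * int u - int (h i)) + (2 * int v - int (h i))"
          by (intro circ_dist_eqD[OF K(1)]) (simp flip: D_eq)
        then show "K dvd 2 * int u - 2 * int v \<or> int M dvd int u + int v - int (h i)"
          using dvd_iff[of "int u + int v - int (h i)"] by (simp add: algebra_simps)
      qed
      have eq_u: "v = u" if "v < M" "K dvd 2 * int u - 2 * int v" for v
        using that dvd_iff[of "int u - int v"] eq_if_dvd[of u v] u by (simp add: algebra_simps)
      show "card A \<le> 2"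
      proof (cases "M \<in> A")
        case False
        \<comment> \<open>\<open>w\<close> is the mirror image of \<open>u\<close>; only its
          uniqueness needs proof, since existence comes from the vertex \<open>v\<close> at
          hand.\<close>
        define w where "w = (THE w. w < M \<and> int M dvd int u + int w - int (h i))"
        have "v = u \<or> v = w" if v: "v \<in> A" for v
        proof -
          have "v < M" using v False M by (auto simp: A_def less_Suc_eq)
          moreover have "v = w" if "int M dvd int u + int v - int (h i)"
            unfolding w_def
          proof (rule the_equality[symmetric])
            fix w assume w: "w < M \<and> int M dvd int u + int w - int (h i)"
            have "int M dvd (int u + int w - int (h i)) - (int u + int v - int (h i))"
              using w that by (blast intro: dvd_diff)
            then show "w = v" using eq_if_dvd[of w v] w \<open>v < M\<close> by simp
          qed (use that \<open>v < M\<close> in simp)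
          ultimately show ?thesis using pair[OF v] eq_u by blast
        qed
        then have "A \<subseteq> {u, w}" by blast
        then have "card A \<le> card {u, w}" by (intro card_mono) auto
        also have "\<dots> \<le> 2" by (simp add: card_insert_if)
        finally show ?thesis .
      next
        case True
        then obtain j where j: "j < M" "t = j * n div 2" by (auto simp: A_def T_def)
        have blk: "k = i" if "S k \<le> t" "t < S (Suc k)" for k
          by (rule mono_block_unique[OF S_mono, where t = t])
            (use that block[OF i(1), of u] i in auto)
        \<comment> \<open>The label \<open>j * n div 2\<close> is the first of class
          \<open>j\<close> if \<open>j * n\<close> is even and the last of class
          \<open>j - 1\<close> otherwise, so \<open>u\<close> is the centre or its antipode.\<close>
        have D0: "D i u = 0 \<or> D i u = M"
        proof (cases "even (j * n)")
          case True
          then have "t = S j" unfolding j S_def by presburger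
          with block[OF j(1), of u] blk[of j] have "j = i" by simp
          with i \<open>t = S j\<close> have "D i u div 2 = 0" by simp
          moreover have "even (D i u)" using D_par[OF i(1), of u] True \<open>j = i\<close> by auto
          ultimately show ?thesis by presburger
        next
          case False
          then have "odd n" "odd j" by auto
          then obtain k where k: "j = Suc k" "even k" by (metis even_Suc oddE add.commute plus_1_eq_Suc dvd_triv_left)
          have "even (k * n)" using k by simp
          then have t: "t = S k + n div 2" "t < S (Suc k)"
            using \<open>odd n\<close> unfolding j k S_def mult_Suc by presburger+
          with blk[of k] have "k = i" by simp
          with t i have "D i u div 2 = n div 2" by simp
          moreover have "even (D i u)" using D_par[OF i(1), of u] k \<open>k = i\<close> by auto
          ultimately show ?thesis using \<open>odd n\<close> M(2) by presburger
        qed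
        \<comment> \<open>Centre and antipode are their own mirror images, so \<open>u\<close>
          shares \<open>t\<close> with no other circle vertex.\<close>
        have "v = u" if v: "v \<in> A" "v < M" for v
        proof -
          obtain k where k: "int (D i u) = \<bar>2 * int u - int (h i) - K * k\<bar>"
            using circ_dist_attained[OF K(1)] unfolding D_eq by metis
          have "K dvd 2 * int (D i u)" using D0 by (auto simp: K_def)
          then have "K dvd 2 * (2 * int u - int (h i) - K * k)"
            unfolding k by (metis abs_mult abs_numeral dvd_abs_iff)
          then have "K dvd 2 * (2 * int u - int (h i) - K * k) + K * (2 * k)"
            by (rule dvd_add) simp
          then have dvd: "K dvd 2 * (2 * int u - int (h i))" by (simp add: algebra_simps)
          have "K dvd 2 * int u - 2 * int v" if "int M dvd int u + int v - int (h i)"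
          proof -
            have "K dvd 2 * (2 * int u - int (h i)) - 2 * (int u + int v - int (h i))"
              using dvd that dvd_iff by (blast intro: dvd_diff)
            then show ?thesis by (simp add: algebra_simps)
          qed
          with pair[OF v] eq_u[OF v(2)] show ?thesis by blast
        qed
        then have "A \<subseteq> {u, M}" using M by (auto simp: A_def less_Suc_eq)
        then have "card A \<le> card {u, M}" by (intro card_mono) auto
        also have "\<dots> \<le> 2" by (simp add: card_insert_if)
        finally show ?thesis .
      qed
    qed
  qed
qed

section \<open>Combining the two bounds\<close>

theorem theorem4:
  fixes n r :: nat
  assumes "n \<ge> 3" and "1 \<le> r" and "r \<le> n - 2"
    and "even n \<or> even r \<or>
         (odd n \<and> (real r \<ge> (real n - 1) / 2 \<or> gcd r (n - 1) = 1))"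
  shows "int (ms r (complete_graph n)) = \<lfloor>(real r * real n - 1) / 2\<rfloor>"
proof -
  have r: "0 < r" "r + 2 \<le> n" using assms by auto
  obtain h where h:
    "\<And>i. i < n - 1 \<Longrightarrow> even (h i) \<longleftrightarrow> even n \<or> even i"
    "\<And>i. i + r < n - 1 \<Longrightarrow> \<bar>int (h (i + r)) - int (h i)\<bar> \<le> 2"
    "\<And>k. k < n - 1 \<Longrightarrow> (if even n then 2 * k else k) \<in> h ` {..<n - 1}"
    using ex_half_centres[OF assms(1) r(1)] by metis
  have ge: "(r * n - 1) div 2 \<le> ms r (complete_graph n)"
    by (rule le_ms_complete_graph[where h = h]) (use assms(1) r h in auto)
  have "ms r (complete_graph n) \<in>
      {ms_ordering r (complete_graph n) l | l. is_ordering (complete_graph n) l}"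
    unfolding ms_def using ms_set[OF simple_graph_complete_graph[of n]] by (rule Max_in)
  then have "2 * ms r (complete_graph n) < r * n"
    using ms_ordering_complete_graph_less[OF r] by auto
  with ge have eq: "ms r (complete_graph n) = (r * n - 1) div 2" by linarith
  \<comment> \<open>Positivity makes the truncated \<open>r * n - 1\<close> agree with real
    subtraction.\<close>
  have "0 < r * n" using r by simp
  then have "(real r * real n - 1) / 2 = real_of_int (int (r * n - 1)) / real_of_int 2"
    by (simp add: of_nat_diff)
  then show ?thesis unfolding eq by (simp only: floor_divide_of_int_eq zdiv_int of_nat_numeral)
qed

end
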